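(* Let $\mathcal{D}$ be a design. Then there exists a hierarchical identifiable saturated (HIS) model that is supported by $\mathcal{D}$.
   Context: A design $\mathcal{D}$ is a set of $n>1$ distinct points in $\mathbb{R}^r$, with coordinates (indeterminates) $x_1,\dots,x_r$, such that $x_j$ takes $n_j>1$ distinct values over the points of $\mathcal{D}$, for $j=1,\dots,r$. Let $(x_{i1},\dots,x_{ir})$ denote the $i$th point, $i=1,\dots,n$. A monomial is $x^\alpha = x_1^{\alpha_1}\cdots x_r^{\alpha_r}$ with $\alpha=(\alpha_1,\dots,\alpha_r)\in\mathbb{Z}_{\ge 0}^r$; it is identified with the $r$-tuple $\alpha$. The monomial vector $\mathbf{x}^\alpha\in\mathbb{R}^n$ of $\alpha$ has $i$th entry $\prod_{j=1}^r x_{ij}^{\alpha_j}$ (with $0^0=1$). A (polynomial) model with $p$ terms is $E[Y]=\sum_{k=1}^p \theta_{\alpha_k}x^{\alpha_k}$ with $\alpha_1,\dots,\alpha_p$ distinct monomials and unknown coefficients $\theta_{\alpha_k}$; it is determined by its set of monomials $\{\alpha_1,\dots,\alpha_p\}$. It is identifiable from (supported by) $\mathcal{D}$ if the $n\times p$ model matrix with columns $\mathbf{x}^{\alpha_1},\dots,\mathbf{x}^{\alpha_p}$ has rank $p$. An identifiable model is saturated if $p=n$. A model is hierarchical if for every monomial $\alpha$ in the model, every $\beta\in\mathbb{Z}_{\ge 0}^r$ with $\beta_j\le\alpha_j$ for all $j=1,\dots,r$ is also in the model. A HIS model is one that is hierarchical, identifiable and saturated. *)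

theory Defs
  imports "Jordan_Normal_Form.DL_Rank"
begin

text \<open>
  The ambient space \<open>\<real>\<^sup>r\<close> is \<open>carrier_vec r :: real vec set\<close>, and a monomial is identified with its
  exponent tuple, an element of \<open>carrier_vec r :: nat vec set\<close>. Coordinates are numbered from 0.
  A model is identified with its set of monomials.
\<close>

definition design :: "nat \<Rightarrow> real vec set \<Rightarrow> bool" where
  "design r D \<longleftrightarrow>
     D \<subseteq> carrier_vec r \<and> finite D \<and> card D > 1 \<and>
     (\<forall>j<r. card ((\<lambda>x. x $ j) ` D) > 1)"

definition monomial_value :: "nat vec \<Rightarrow> real vec \<Rightarrow> real" where
  "monomial_value \<alpha> x = (\<Prod>j<dim_vec \<alpha>. (x $ j) ^ (\<alpha> $ j))"

definition monomial_vector :: "real vec list \<Rightarrow> nat vec \<Rightarrow> real vec" where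
  "monomial_vector xs \<alpha> = vec (length xs) (\<lambda>i. monomial_value \<alpha> (xs ! i))"

definition model_matrix :: "real vec list \<Rightarrow> nat vec list \<Rightarrow> real mat" where
  "model_matrix xs \<alpha>s = mat_of_cols (length xs) (map (monomial_vector xs) \<alpha>s)"

definition model :: "nat \<Rightarrow> nat vec set \<Rightarrow> bool" where
  "model r M \<longleftrightarrow> finite M \<and> M \<subseteq> carrier_vec r"

text \<open>
  The model matrix depends on a numbering of the points of \<open>D\<close> and of the monomials of \<open>M\<close>, its
  rank does not; the rank condition is imposed for every numbering. For finite \<open>D\<close> and \<open>M\<close>
  numberings exist, so the condition is not vacuous.
\<close>

definition identifiable :: "real vec set \<Rightarrow> nat vec set \<Rightarrow> bool" where
  "identifiable D M \<longleftrightarrow>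
     (\<forall>xs \<alpha>s. distinct xs \<and> set xs = D \<and> distinct \<alpha>s \<and> set \<alpha>s = M \<longrightarrow>
        vec_space.rank (length xs) (model_matrix xs \<alpha>s) = length \<alpha>s)"

definition saturated :: "real vec set \<Rightarrow> nat vec set \<Rightarrow> bool" where
  "saturated D M \<longleftrightarrow> identifiable D M \<and> card M = card D"

definition hierarchical :: "nat \<Rightarrow> nat vec set \<Rightarrow> bool" where
  "hierarchical r M \<longleftrightarrow>
     (\<forall>\<alpha>\<in>M. \<forall>\<beta>\<in>carrier_vec r. (\<forall>j<r. \<beta> $ j \<le> \<alpha> $ j) \<longrightarrow> \<beta> \<in> M)"

definition his_model :: "nat \<Rightarrow> real vec set \<Rightarrow> nat vec set \<Rightarrow> bool" where
  "his_model r D M \<longleftrightarrow>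
     model r M \<and> hierarchical r M \<and> identifiable D M \<and> saturated D M"

end

theory Submission
  imports Defs
begin

text \<open>
  The model consists of the standard monomials of the lexicographic order, described through linear
  functionals rather than through spans or a vanishing ideal. A weight \<open>l\<close> on the points defines
  the functional \<open>moment D l\<close>, sending a monomial \<open>\<alpha>\<close> to the sum of
  \<open>l x * monomial_value \<alpha> x\<close> over \<open>D\<close>. A monomial is standard if it is the lexicographically first one
  on which some such functional does not vanish.

  This formulation makes all required properties short. If \<open>l\<close> witnesses \<open>\<alpha>\<close> and \<open>\<gamma>\<close> divides
  \<open>\<alpha>\<close>, then \<open>l\<close> times the quotient monomial witnesses \<open>\<gamma>\<close>, because the lexicographic order
  is compatible with multiplication; so the standard monomials are hierarchical
  (\<open>standard_divisor\<close>). They are independent on \<open>D\<close>, because applying the witness of the last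
  monomial of a linear relation isolates its coefficient (\<open>standard_independent\<close>).

  The count rests on homogeneous systems with more unknowns than equations
  (\<open>homogeneous_system_nontrivial_solution\<close>). Used on linear relations, it shows that more than
  \<open>card D\<close> monomials are dependent on \<open>D\<close>, so there are at most \<open>card D\<close> standard ones. Used on
  weights, it shows that fewer than \<open>card D\<close> standard monomials would all be annihilated by some
  nonzero weight. By interpolation the moments of this weight do not all vanish
  (\<open>nonzero_weight_has_nonzero_moment\<close>), and the first nonvanishing one would be at a standard
  monomial, a contradiction.
\<close>

section \<open>Homogeneous linear systems and column rank\<close>

text \<open>
  Gaussian elimination of one equation and one unknown at a time.
\<close>

lemma homogeneous_system_nontrivial_solution:
  fixes f :: "'a \<Rightarrow> 'b \<Rightarrow> 'c :: field"
  assumes "finite A" "finite B" "card A < card B"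
  shows "\<exists>c. (\<exists>b\<in>B. c b \<noteq> 0) \<and> (\<forall>a\<in>A. (\<Sum>b\<in>B. c b * f a b) = 0)"
  using assms
proof (induction A arbitrary: B f rule: finite_induct)
  case empty
  then have "B \<noteq> {}" by auto
  then show ?case by (intro exI[of _ "\<lambda>_. 1"]) auto
next
  case (insert a A)
  show ?case
  proof (cases "\<forall>b\<in>B. f a b = 0")
    case True
    have "card A < card B" using insert.prems insert.hyps by simp
    from insert.IH[OF insert.prems(1) this, of f] True show ?thesis by auto
  next
    case False
    then obtain p where p: "p \<in> B" "f a p \<noteq> 0" by auto
    define g where "g = (\<lambda>a' b. f a' b - f a b / f a p * f a' p)"
    have "card A < card (B - {p})" using insert.prems insert.hyps p by simp
    from insert.IH[OF _ this, of g] insert.prems(1) obtain c where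
      c: "\<exists>b\<in>B-{p}. c b \<noteq> 0" "\<And>a'. a' \<in> A \<Longrightarrow> (\<Sum>b\<in>B-{p}. c b * g a' b) = 0"
      by auto
    define s where "s = (\<Sum>b\<in>B-{p}. c b * f a b)"
    define d where "d = c(p := - s / f a p)"
    have split: "(\<Sum>b\<in>B. d b * f a' b) = (\<Sum>b\<in>B-{p}. c b * f a' b) - s / f a p * f a' p" for a'
      using insert.prems(1) p(1) by (simp add: sum.remove[of B p] d_def)
    have elim: "(\<Sum>b\<in>B-{p}. c b * g a' b) = (\<Sum>b\<in>B-{p}. c b * f a' b) - s / f a p * f a' p" for a'
      unfolding g_def s_def
      by (simp add: algebra_simps sum_subtractf sum_distrib_left sum_divide_distrib)
    have "(\<Sum>b\<in>B. d b * f a b) = 0"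
      using p(2) by (simp add: split s_def[symmetric])
    moreover have "(\<Sum>b\<in>B. d b * f a' b) = 0" if "a' \<in> A" for a'
      using c(2)[OF that] elim[of a'] split[of a'] by simp
    moreover have "\<exists>b\<in>B. d b \<noteq> 0" using c(1) by (auto simp: d_def)
    ultimately show ?thesis by auto
  qed
qed

lemma trivial_kernel_imp_full_column_rank:
  fixes A :: "'a :: field mat"
  assumes A: "A \<in> carrier_mat n nc"
    and ker: "\<And>v. v \<in> carrier_vec nc \<Longrightarrow> A *\<^sub>v v = 0\<^sub>v n \<Longrightarrow> v = 0\<^sub>v nc"
  shows "vec_space.rank n A = nc"
proof -
  have "distinct (cols A)"
  proof (rule ccontr)
    assume "\<not> distinct (cols A)"
    then obtain i j where ij: "i < nc" "j < nc" "i \<noteq> j" "col A i = col A j"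
      using A by (auto simp: distinct_conv_nth)
    have "A *\<^sub>v (unit_vec nc i - unit_vec nc j) = A *\<^sub>v unit_vec nc i - A *\<^sub>v unit_vec nc j"
      using A by (intro mult_minus_distrib_mat_vec) auto
    also have "\<dots> = col A i - col A j"
      using A ij(1,2) by (intro eq_vecI) auto
    also have "\<dots> = 0\<^sub>v n"
      unfolding ij(4) using A ij(2) by (intro eq_vecI) auto
    finally have "unit_vec nc i - unit_vec nc j = (0\<^sub>v nc :: 'a vec)"
      by (intro ker) auto
    then have "(unit_vec nc i - unit_vec nc j) $ i = (0\<^sub>v nc :: 'a vec) $ i" by simp
    then show False using ij by simp
  qed
  then show ?thesis
    using vec_space.lin_indpt_full_rank[OF A] vec_space.lin_depE[OF A] ker by metis
qed

section \<open>The lexicographic order on monomials\<close>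

definition lex_less :: "nat \<Rightarrow> nat vec \<Rightarrow> nat vec \<Rightarrow> bool" where
  "lex_less r \<alpha> \<beta> \<longleftrightarrow> (\<exists>k<r. \<alpha> $ k < \<beta> $ k \<and> (\<forall>j<k. \<alpha> $ j = \<beta> $ j))"

lemma lex_less_transp: "transp_on A (lex_less r)"
proof (rule transp_onI)
  fix \<alpha> \<beta> \<gamma> assume "lex_less r \<alpha> \<beta>" "lex_less r \<beta> \<gamma>"
  then obtain k l where
    k: "k < r" "\<alpha> $ k < \<beta> $ k" "\<forall>j<k. \<alpha> $ j = \<beta> $ j" and
    l: "l < r" "\<beta> $ l < \<gamma> $ l" "\<forall>j<l. \<beta> $ j = \<gamma> $ j"
    unfolding lex_less_def by blast
  have "\<alpha> $ min k l < \<gamma> $ min k l"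
    using k l by (cases k l rule: linorder_cases) auto
  then show "lex_less r \<alpha> \<gamma>"
    unfolding lex_less_def using k l by (intro exI[of _ "min k l"]) auto
qed

lemma lex_less_asymp: "asymp_on A (lex_less r)"
proof (rule asymp_onI, rule notI)
  fix \<alpha> \<beta> assume "lex_less r \<alpha> \<beta>" "lex_less r \<beta> \<alpha>"
  then have "lex_less r \<alpha> \<alpha>"
    using transp_onD[OF lex_less_transp[of UNIV r], of \<alpha> \<beta> \<alpha>] by simp
  then show False by (simp add: lex_less_def)
qed

lemma lex_less_total:
  assumes "\<alpha> \<in> carrier_vec r" "\<beta> \<in> carrier_vec r" "\<alpha> \<noteq> \<beta>"
  shows "lex_less r \<alpha> \<beta> \<or> lex_less r \<beta> \<alpha>"
proof -
  have "\<exists>k. k < r \<and> \<alpha> $ k \<noteq> \<beta> $ k" using assms by auto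
  from exists_least_iff[THEN iffD1, OF this] obtain k where
    "k < r" "\<alpha> $ k \<noteq> \<beta> $ k" "\<forall>j<k. \<alpha> $ j = \<beta> $ j" by auto
  then show ?thesis unfolding lex_less_def by (metis linorder_neqE_nat)
qed

lemma lex_less_add_right:
  assumes "\<alpha> \<in> carrier_vec r" "\<beta> \<in> carrier_vec r" "\<delta> \<in> carrier_vec r" "lex_less r \<alpha> \<beta>"
  shows "lex_less r (\<alpha> + \<delta>) (\<beta> + \<delta>)"
proof -
  from assms(4) obtain k where "k < r" "\<alpha> $ k < \<beta> $ k" "\<forall>j<k. \<alpha> $ j = \<beta> $ j"
    unfolding lex_less_def by blast
  then show ?thesis using assms(1-3) unfolding lex_less_def by (intro exI[of _ k]) auto
qed

lemma wf_lex_less: "wf {(\<alpha>, \<beta>). \<alpha> \<in> carrier_vec r \<and> \<beta> \<in> carrier_vec r \<and> lex_less r \<alpha> \<beta>}"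
proof (rule wf_subset)
  show "wf (inv_image (lexn less_than r) list_of_vec)"
    by (intro wf_inv_image wf_lexn wf_less_than)
  show "{(\<alpha>, \<beta>). \<alpha> \<in> carrier_vec r \<and> \<beta> \<in> carrier_vec r \<and> lex_less r \<alpha> \<beta>}
    \<subseteq> inv_image (lexn less_than r) list_of_vec"
  proof clarify
    fix \<alpha> \<beta> :: "nat vec"
    assume r: "\<alpha> \<in> carrier_vec r" "\<beta> \<in> carrier_vec r" and "lex_less r \<alpha> \<beta>"
    then obtain k where k: "k < r" "\<alpha> $ k < \<beta> $ k" "\<forall>j<k. \<alpha> $ j = \<beta> $ j"
      unfolding lex_less_def by blast
    let ?a = "list_of_vec \<alpha>" and ?b = "list_of_vec \<beta>"
    have len: "length ?a = r" "length ?b = r" using r by auto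
    have nth: "?a ! j = \<alpha> $ j" "?b ! j = \<beta> $ j" if "j < r" for j
      using r that by (auto simp: list_of_vec_index)
    have "take k ?a = take k ?b" using k len nth by (intro nth_take_lemma) auto
    then have "?a = take k ?a @ \<alpha> $ k # drop (Suc k) ?a"
      "?b = take k ?a @ \<beta> $ k # drop (Suc k) ?b"
      using id_take_nth_drop[of k ?a] id_take_nth_drop[of k ?b] len nth k(1) by auto
    then show "(\<alpha>, \<beta>) \<in> inv_image (lexn less_than r) list_of_vec"
      using k(2) len by (auto simp: lexn_conv)
  qed
qed

section \<open>Functionals given by weights on the points\<close>

definition moment :: "real vec set \<Rightarrow> (real vec \<Rightarrow> real) \<Rightarrow> nat vec \<Rightarrow> real" where
  "moment D l \<alpha> = (\<Sum>x\<in>D. l x * monomial_value \<alpha> x)"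

lemma monomial_value_add:
  assumes "\<alpha> \<in> carrier_vec r" "\<beta> \<in> carrier_vec r"
  shows "monomial_value (\<alpha> + \<beta>) x = monomial_value \<alpha> x * monomial_value \<beta> x"
  using assms by (auto simp: monomial_value_def power_add prod.distrib)

lemma monomial_value_unit_vec:
  assumes "j < r"
  shows "monomial_value (unit_vec r j) x = x $ j"
proof -
  have "monomial_value (unit_vec r j) x = (\<Prod>i<r. if i = j then x $ i else 1)"
    unfolding monomial_value_def using assms by (intro prod.cong) auto
  then show ?thesis using assms by simp
qed

lemma monomial_value_zero: "monomial_value (0\<^sub>v r) x = 1"
  by (simp add: monomial_value_def)

lemma moment_mult:
  assumes "\<alpha> \<in> carrier_vec r" "\<delta> \<in> carrier_vec r"
  shows "moment D (\<lambda>x. l x * monomial_value \<delta> x) \<alpha> = moment D l (\<alpha> + \<delta>)"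
  by (simp add: moment_def monomial_value_add[OF assms] mult_ac)

text \<open>
  If all moments of \<open>l\<close> vanish, then so do those of \<open>l\<close> multiplied by any polynomial. A product of
  linear factors, each vanishing at one of the other points but not at \<open>x0\<close>, leaves only the
  contribution of \<open>x0\<close> to the zeroth moment.
\<close>

lemma nonzero_weight_has_nonzero_moment:
  assumes D: "finite D" "D \<subseteq> carrier_vec r" and x0: "x0 \<in> D" "l x0 \<noteq> 0"
  shows "\<exists>\<alpha>\<in>carrier_vec r. moment D l \<alpha> \<noteq> 0"
proof (rule ccontr)
  assume "\<not> ?thesis"
  then have zero: "moment D l \<alpha> = 0" if "\<alpha> \<in> carrier_vec r" for \<alpha> using that by blast
  have "\<forall>y\<in>D - {x0}. \<exists>j<r. x0 $ j \<noteq> y $ j"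
  proof
    fix y assume "y \<in> D - {x0}"
    then have "y \<in> carrier_vec r" "x0 \<in> carrier_vec r" "x0 \<noteq> y" using D x0 by auto
    then show "\<exists>j<r. x0 $ j \<noteq> y $ j" by auto
  qed
  then obtain j where j: "\<And>y. y \<in> D - {x0} \<Longrightarrow> j y < r \<and> x0 $ j y \<noteq> y $ j y" by metis
  have vanish: "moment D (\<lambda>x. l x * (\<Prod>y\<in>S. x $ j y - y $ j y)) \<alpha> = 0"
    if "finite S" "S \<subseteq> D - {x0}" "\<alpha> \<in> carrier_vec r" for S \<alpha>
    using that
  proof (induction S arbitrary: \<alpha> rule: finite_induct)
    case empty
    then show ?case using zero by simp
  next
    case (insert y S)
    let ?l = "\<lambda>x. l x * (\<Prod>y\<in>S. x $ j y - y $ j y)"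
    have jy: "j y < r" using j insert.prems by auto
    then have u: "unit_vec r (j y) \<in> carrier_vec r" by simp
    have "moment D (\<lambda>x. l x * (\<Prod>y\<in>insert y S. x $ j y - y $ j y)) \<alpha>
      = moment D (\<lambda>x. ?l x * monomial_value (unit_vec r (j y)) x) \<alpha> - y $ j y * moment D ?l \<alpha>"
      using insert.hyps unfolding moment_def monomial_value_unit_vec[OF jy]
      by (simp add: sum_subtractf sum_distrib_left algebra_simps)
    also have "\<dots> = moment D ?l (\<alpha> + unit_vec r (j y)) - y $ j y * moment D ?l \<alpha>"
      using moment_mult[OF insert.prems(2) u] by simp
    also have "\<dots> = 0" using insert.IH insert.prems u by simp
    finally show ?case .
  qed
  let ?q = "\<lambda>x. \<Prod>y\<in>D-{x0}. x $ j y - y $ j y"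
  have "0 = (\<Sum>x\<in>D. l x * ?q x)"
    using vanish[of "D - {x0}" "0\<^sub>v r"] D by (simp add: moment_def monomial_value_zero)
  also have "\<dots> = l x0 * ?q x0 + (\<Sum>x\<in>D-{x0}. l x * ?q x)"
    using D x0 by (simp add: sum.remove)
  also have "(\<Sum>x\<in>D-{x0}. l x * ?q x) = 0"
    using D by (intro sum.neutral ballI) auto
  finally have "?q x0 = 0" using x0 by simp
  then show False using D j by auto
qed

section \<open>Standard monomials\<close>

definition standard_monomials :: "nat \<Rightarrow> real vec set \<Rightarrow> nat vec set" where
  "standard_monomials r D = {\<alpha> \<in> carrier_vec r. \<exists>l. moment D l \<alpha> \<noteq> 0 \<and>
     (\<forall>\<beta>\<in>carrier_vec r. lex_less r \<beta> \<alpha> \<longrightarrow> moment D l \<beta> = 0)}"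

lemma standard_monomials_carrier: "standard_monomials r D \<subseteq> carrier_vec r"
  by (auto simp: standard_monomials_def)

text \<open>
  Multiplying the weight by the quotient monomial shifts its moments, so that the first
  nonvanishing one moves from the given monomial to its divisor.
\<close>

lemma standard_divisor:
  assumes \<alpha>: "\<alpha> \<in> standard_monomials r D"
    and \<gamma>: "\<gamma> \<in> carrier_vec r" "\<forall>j<r. \<gamma> $ j \<le> \<alpha> $ j"
  shows "\<gamma> \<in> standard_monomials r D"
proof -
  from \<alpha> obtain l where \<alpha>r: "\<alpha> \<in> carrier_vec r" and l: "moment D l \<alpha> \<noteq> 0"
    "\<And>\<beta>. \<beta> \<in> carrier_vec r \<Longrightarrow> lex_less r \<beta> \<alpha> \<Longrightarrow> moment D l \<beta> = 0"
    by (auto simp: standard_monomials_def)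
  define \<delta> where "\<delta> = vec r (\<lambda>j. \<alpha> $ j - \<gamma> $ j)"
  have \<delta>: "\<delta> \<in> carrier_vec r" by (simp add: \<delta>_def)
  have sum: "\<gamma> + \<delta> = \<alpha>" using \<alpha>r \<gamma> by (auto simp: \<delta>_def)
  let ?l = "\<lambda>x. l x * monomial_value \<delta> x"
  have "moment D ?l \<gamma> \<noteq> 0" using l(1) by (simp add: moment_mult[OF \<gamma>(1) \<delta>] sum)
  moreover have "moment D ?l \<beta> = 0" if "\<beta> \<in> carrier_vec r" "lex_less r \<beta> \<gamma>" for \<beta>
    using l(2) lex_less_add_right[OF that(1) \<gamma>(1) \<delta> that(2)] that(1) \<delta>
    by (simp add: moment_mult[OF that(1) \<delta>] sum)
  ultimately show ?thesis using \<gamma>(1) unfolding standard_monomials_def by blast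
qed

text \<open>
  In a linear relation, the witness of the last monomial with nonzero coefficient annihilates
  every other term.
\<close>

lemma standard_independent:
  assumes A: "finite A" "A \<subseteq> standard_monomials r D"
    and rel: "\<And>x. x \<in> D \<Longrightarrow> (\<Sum>\<alpha>\<in>A. c \<alpha> * monomial_value \<alpha> x) = 0"
    and "\<alpha> \<in> A"
  shows "c \<alpha> = 0"
proof (rule ccontr)
  assume "c \<alpha> \<noteq> 0"
  let ?B = "{\<beta> \<in> A. c \<beta> \<noteq> 0}"
  have "finite ?B" "?B \<noteq> {}" using A \<open>\<alpha> \<in> A\<close> \<open>c \<alpha> \<noteq> 0\<close> by auto
  then obtain \<mu> where \<mu>: "\<mu> \<in> ?B" "\<forall>\<beta>\<in>?B. \<beta> \<noteq> \<mu> \<longrightarrow> \<not> lex_less r \<mu> \<beta>"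
    using Finite_Set.bex_max_element[of ?B "lex_less r", OF _ lex_less_asymp lex_less_transp]
    by blast
  then have "\<mu> \<in> standard_monomials r D" using A by auto
  then obtain l where \<mu>r: "\<mu> \<in> carrier_vec r" and l: "moment D l \<mu> \<noteq> 0"
    "\<And>\<beta>. \<beta> \<in> carrier_vec r \<Longrightarrow> lex_less r \<beta> \<mu> \<Longrightarrow> moment D l \<beta> = 0"
    by (auto simp: standard_monomials_def)
  have other: "c \<beta> * moment D l \<beta> = 0" if "\<beta> \<in> A - {\<mu>}" for \<beta>
  proof (cases "c \<beta> = 0")
    case False
    have "\<beta> \<in> carrier_vec r" using that A standard_monomials_carrier by blast
    then show ?thesis using lex_less_total[OF _ \<mu>r, of \<beta>] \<mu> l(2) that False by auto
  qed simp
  have "0 = (\<Sum>x\<in>D. l x * (\<Sum>\<beta>\<in>A. c \<beta> * monomial_value \<beta> x))" using rel by simp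
  also have "\<dots> = (\<Sum>\<beta>\<in>A. c \<beta> * moment D l \<beta>)"
    unfolding moment_def sum_distrib_left by (subst sum.swap) (simp add: mult_ac)
  also have "\<dots> = c \<mu> * moment D l \<mu>"
  proof -
    have "(\<Sum>\<beta>\<in>A - {\<mu>}. c \<beta> * moment D l \<beta>) = 0"
      using other by (intro sum.neutral) blast
    then show ?thesis using A \<mu>(1) by (simp add: sum.remove[of A \<mu>])
  qed
  finally show False using \<mu>(1) l(1) by simp
qed

lemma first_nonzero_moment_standard:
  assumes "\<alpha> \<in> carrier_vec r" "moment D l \<alpha> \<noteq> 0"
  shows "\<exists>\<beta>\<in>standard_monomials r D. moment D l \<beta> \<noteq> 0"
proof -
  let ?Q = "{\<beta> \<in> carrier_vec r. moment D l \<beta> \<noteq> 0}"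
  have "\<alpha> \<in> ?Q" using assms by simp
  from wfE_min[OF wf_lex_less this] obtain \<beta> where "\<beta> \<in> ?Q"
    "\<And>\<gamma>. (\<gamma>, \<beta>) \<in> {(\<alpha>, \<beta>). \<alpha> \<in> carrier_vec r \<and> \<beta> \<in> carrier_vec r \<and> lex_less r \<alpha> \<beta>} \<Longrightarrow> \<gamma> \<notin> ?Q"
    by blast
  then have "\<beta> \<in> standard_monomials r D" "moment D l \<beta> \<noteq> 0"
    unfolding standard_monomials_def by auto
  then show ?thesis by blast
qed

lemma standard_subset_card_le:
  assumes "finite D" "finite A" "A \<subseteq> standard_monomials r D"
  shows "card A \<le> card D"
proof (rule ccontr)
  assume "\<not> card A \<le> card D"
  then have "card D < card A" by simp
  from homogeneous_system_nontrivial_solution[OF assms(1,2) this,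
      of "\<lambda>x \<alpha>. monomial_value \<alpha> x"]
  obtain c where "\<exists>\<alpha>\<in>A. c \<alpha> \<noteq> 0" "\<forall>x\<in>D. (\<Sum>\<alpha>\<in>A. c \<alpha> * monomial_value \<alpha> x) = 0"
    by blast
  then show False using standard_independent[OF assms(2,3)] by blast
qed

lemma finite_standard_monomials:
  assumes "finite D"
  shows "finite (standard_monomials r D)"
proof (rule ccontr)
  assume "infinite (standard_monomials r D)"
  from infinite_arbitrarily_large[OF this, of "Suc (card D)"] obtain A where
    "finite A" "card A = Suc (card D)" "A \<subseteq> standard_monomials r D" by blast
  then show False using standard_subset_card_le[OF assms, of A r] by simp
qed

lemma card_standard_monomials:
  assumes "finite D" "D \<subseteq> carrier_vec r"
  shows "card (standard_monomials r D) = card D"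
proof (rule antisym)
  note fin = finite_standard_monomials[OF assms(1), of r]
  show "card (standard_monomials r D) \<le> card D"
    by (rule standard_subset_card_le[OF assms(1) fin order_refl])
  show "card D \<le> card (standard_monomials r D)"
  proof (rule ccontr)
    assume "\<not> card D \<le> card (standard_monomials r D)"
    then have "card (standard_monomials r D) < card D" by simp
    from homogeneous_system_nontrivial_solution[OF fin assms(1) this, of monomial_value]
    obtain l x0 where x0: "x0 \<in> D" "l x0 \<noteq> 0"
      and l: "\<forall>\<alpha>\<in>standard_monomials r D. moment D l \<alpha> = 0"
      unfolding moment_def by blast
    from nonzero_weight_has_nonzero_moment[of D r x0 l, OF assms x0]
    show False using first_nonzero_moment_standard l by blast
  qed
qed

lemma identifiable_standard_monomials: "identifiable D (standard_monomials r D)"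
  unfolding identifiable_def
proof (intro allI impI, elim conjE)
  fix xs \<alpha>s
  assume xs: "distinct xs" "set xs = D"
    and as: "distinct \<alpha>s" "set \<alpha>s = standard_monomials r D"
  let ?A = "model_matrix xs \<alpha>s"
  have A: "?A \<in> carrier_mat (length xs) (length \<alpha>s)"
    by (simp add: model_matrix_def mat_of_cols_def)
  show "vec_space.rank (length xs) ?A = length \<alpha>s"
  proof (rule trivial_kernel_imp_full_column_rank[OF A])
    fix v assume v: "v \<in> carrier_vec (length \<alpha>s)" and ker: "?A *\<^sub>v v = 0\<^sub>v (length xs)"
    \<comment> \<open>The kernel vector, reindexed by monomials instead of positions in the list.\<close>
    define c where "c \<alpha> = v $ the_inv_into {..<length \<alpha>s} ((!) \<alpha>s) \<alpha>" for \<alpha>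
    have bij: "bij_betw ((!) \<alpha>s) {..<length \<alpha>s} (standard_monomials r D)"
      using as by (intro bij_betw_nth) auto
    have c: "c (\<alpha>s ! k) = v $ k" if "k < length \<alpha>s" for k
      using bij that by (simp add: c_def bij_betw_def the_inv_into_f_f)
    have "(\<Sum>\<alpha>\<in>standard_monomials r D. c \<alpha> * monomial_value \<alpha> x) = 0" if "x \<in> D" for x
    proof -
      obtain i where i: "i < length xs" "x = xs ! i"
        using \<open>x \<in> D\<close> xs by (auto simp: in_set_conv_nth)
      have "(\<Sum>\<alpha>\<in>standard_monomials r D. c \<alpha> * monomial_value \<alpha> x)
        = (\<Sum>k<length \<alpha>s. v $ k * monomial_value (\<alpha>s ! k) x)"
        by (subst sum.reindex_bij_betw[OF bij, symmetric]) (simp add: c)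
      also have "\<dots> = (?A *\<^sub>v v) $ i"
        using i v A by (auto simp: scalar_prod_def model_matrix_def mat_of_cols_def
            monomial_vector_def atLeast0LessThan mult.commute intro!: sum.cong)
      also have "\<dots> = 0" using ker i by simp
      finally show ?thesis .
    qed
    then have "c \<alpha> = 0" if "\<alpha> \<in> standard_monomials r D" for \<alpha>
      using standard_independent[of "standard_monomials r D" r D c] that as
      by (metis List.finite_set order_refl)
    then show "v = 0\<^sub>v (length \<alpha>s)"
      using v c as by (intro eq_vecI) (auto, metis nth_mem)
  qed
qed

theorem theorem3p3:
  fixes r :: nat and D :: "real vec set"
  assumes "design r D"
  shows "\<exists>M. his_model r D M"
proof
  have D: "finite D" "D \<subseteq> carrier_vec r" using assms by (auto simp: design_def)
  have "hierarchical r (standard_monomials r D)"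
    unfolding hierarchical_def using standard_divisor by blast
  then show "his_model r D (standard_monomials r D)"
    unfolding his_model_def model_def saturated_def
    using finite_standard_monomials[OF D(1)] standard_monomials_carrier
      identifiable_standard_monomials card_standard_monomials[OF D] by blast
qed

end
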